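(* Let $\mathcal{A}$ be a complex Banach algebra with identity $1$ and let $a\in\mathcal{A}$. Then the following are equivalent: (1) $a\in\mathcal{A}^d$, i.e. $a$ has a g-Drazin inverse; (2) there exists some $x\in comm(a)$ such that $a-a^2x\in\mathcal{A}^{qnil}$.
   Context: An element $w$ of a Banach algebra $\mathcal{A}$ is quasinilpotent if $\lim_{n\to\infty}\|w^n\|^{1/n}=0$; $\mathcal{A}^{qnil}$ denotes the set of quasinilpotent elements of $\mathcal{A}$. An element $a\in\mathcal{A}$ has a g-Drazin inverse (generalized Drazin inverse) if there exists $b\in\mathcal{A}$ such that $ab=ba$, $b=bab$ and $a-a^2b\in\mathcal{A}^{qnil}$; such $b$ is unique if it exists and is denoted $a^d$. $\mathcal{A}^d$ denotes the set of all elements of $\mathcal{A}$ having a g-Drazin inverse. The commutant is $comm(a)=\{x\in\mathcal{A}: xa=ax\}$. *)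

theory Defs
  imports Complex_Main
begin

text \<open>
  The distribution has no class of complex Banach algebras, so it is built here on top of
  the real ones: scalar multiplication is extended to the complex numbers, and the norm is
  homogeneous for it.  The identity is only required to be a two-sided unit: neither
  \<open>norm 1 = 1\<close> nor \<open>1 \<noteq> 0\<close> is assumed, which is why
  \<^class>\<open>real_normed_algebra_1\<close> is not used.
\<close>

class complex_banach_algebra_1 = real_normed_algebra + monoid_mult + banach +
  fixes scaleC :: "complex \<Rightarrow> 'a \<Rightarrow> 'a" (infixr \<open>*\<^sub>C\<close> 75)
  assumes scaleC_add_right: "c *\<^sub>C (x + y) = c *\<^sub>C x + c *\<^sub>C y"
    and scaleC_add_left: "(c + d) *\<^sub>C x = c *\<^sub>C x + d *\<^sub>C x"
    and scaleC_scaleC: "c *\<^sub>C (d *\<^sub>C x) = (c * d) *\<^sub>C x"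
    and scaleC_of_real: "complex_of_real r *\<^sub>C x = r *\<^sub>R x"
    and mult_scaleC_left: "(c *\<^sub>C x) * y = c *\<^sub>C (x * y)"
    and mult_scaleC_right: "x * (c *\<^sub>C y) = c *\<^sub>C (x * y)"
    and norm_scaleC: "norm (c *\<^sub>C x) = cmod c * norm x"

definition qnil :: "'a::complex_banach_algebra_1 set" where
  "qnil = {w. (\<lambda>n. root n (norm (w ^ n))) \<longlonglongrightarrow> 0}"

definition is_gDrazin_inverse :: "'a::complex_banach_algebra_1 \<Rightarrow> 'a \<Rightarrow> bool" where
  "is_gDrazin_inverse a b \<longleftrightarrow> a * b = b * a \<and> b = b * a * b \<and> a - a\<^sup>2 * b \<in> qnil"

definition gDrazin_invertible :: "'a::complex_banach_algebra_1 set" where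
  "gDrazin_invertible = {a. \<exists>b. is_gDrazin_inverse a b}"

definition comm :: "'a::complex_banach_algebra_1 \<Rightarrow> 'a set" where
  "comm a = {x. x * a = a * x}"

end

theory Submission
  imports Defs
begin

text \<open>
  If \<open>x\<close> commutes with \<open>a\<close> and \<open>y = a - a\<^sup>2x\<close> is quasinilpotent, then \<open>e = ax\<close> satisfies
  \<open>e - e\<^sup>2 = yx\<close>, so it is idempotent up to a quasinilpotent error. With \<open>w = 4(e - e\<^sup>2)\<close> one has
  \<open>(2e - 1)\<^sup>2 = 1 - w\<close>, and the binomial series \<open>s = (1 - w)\<^bsup>-1/2\<^esup>\<close> converges, so that
  \<open>p = (1 + (2e - 1)s)/2\<close> is an idempotent. The error \<open>r = p - e\<close> is a multiple of \<open>y\<close>, hence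
  quasinilpotent, and \<open>axp = (1 - r)p\<close>; therefore \<open>b = xp(1 - r)\<^bsup>-1\<^esup>\<close> satisfies \<open>ab = p\<close>, and
  \<open>a - a\<^sup>2b = a(1 - p)\<close> is again a multiple of \<open>y\<close>.
\<close>

lemma power_mult_commuting:
  fixes y z :: "'a::monoid_mult"
  assumes "y * z = z * y"
  shows "(y * z) ^ n = y ^ n * z ^ n"
proof (induction n)
  case (Suc n)
  have "z * y ^ n = y ^ n * z"
    using power_commuting_commutes[OF assms] by metis
  then have "(y * z) * (y ^ n * z ^ n) = (y * y ^ n) * (z * z ^ n)"
    by (metis mult.assoc)
  with Suc show ?case by simp
qed simp

text \<open>The exponent starts at 1 because \<open>norm 1\<close> may exceed 1 here, so the bound
  can fail for the zeroth power.\<close>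

lemma norm_power_Suc_le:
  fixes z :: "'a::{real_normed_algebra,monoid_mult}"
  shows "norm (z ^ Suc n) \<le> norm z ^ Suc n"
proof (induction n)
  case (Suc n)
  have "norm (z * z ^ Suc n) \<le> norm z * norm (z ^ Suc n)"
    by (rule norm_mult_ineq)
  also have "\<dots> \<le> norm z * norm z ^ Suc n"
    using Suc by (rule mult_left_mono) simp
  finally show ?case by simp
qed simp

text \<open>Since \<open>(y * z) ^ n = y ^ n * z ^ n\<close>, passing to n-th roots costs only the
  constant factor \<open>norm z\<close>. Below, \<open>w\<close>, \<open>r\<close> and
  \<open>a - a\<^sup>2 * b\<close> are all shown to be quasinilpotent as multiples of
  \<open>y\<close>.\<close>

lemma qnil_mult_commuting:
  assumes y: "y \<in> qnil" and yz: "y * z = z * y"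
  shows "y * z \<in> qnil"
proof -
  have "(\<lambda>n. root n (norm (y ^ n))) \<longlonglongrightarrow> 0"
    using y by (simp add: qnil_def)
  moreover have "\<forall>\<^sub>F n in sequentially.
      norm (root n (norm ((y * z) ^ n))) \<le> norm (root n (norm (y ^ n))) * norm z"
    using eventually_gt_at_top[of 0]
  proof eventually_elim
    case (elim n)
    then have "norm (z ^ n) \<le> norm z ^ n"
      by (metis norm_power_Suc_le Suc_pred)
    then have "norm ((y * z) ^ n) \<le> norm (y ^ n) * norm z ^ n"
      unfolding power_mult_commuting[OF yz]
      by (intro order_trans[OF norm_mult_ineq] mult_left_mono) auto
    then have "root n (norm ((y * z) ^ n)) \<le> root n (norm (y ^ n) * norm z ^ n)"
      using elim by simp
    also have "\<dots> = root n (norm (y ^ n)) * norm z"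
      using elim by (simp add: real_root_mult real_root_power_cancel)
    finally show ?case
      using elim by (simp add: real_root_ge_zero)
  qed
  ultimately show ?thesis
    unfolding qnil_def mem_Collect_eq by (rule tendsto_0_le)
qed

text \<open>Root test: the n-th roots eventually fall below 1/2, so a geometric series dominates.
  Bounded coefficients cover both the Neumann series and the inverse square root.\<close>

lemma summable_norm_qnil_powser:
  assumes w: "w \<in> qnil" and c: "\<And>n. \<bar>c n\<bar> \<le> 1"
  shows "summable (\<lambda>n. norm (c n *\<^sub>R w ^ n))"
proof (rule summable_comparison_test_ev[OF _ summable_geometric[of "1/2 :: real"]])
  have "\<forall>\<^sub>F n in sequentially. root n (norm (w ^ n)) < 1/2"
    using w by (intro order_tendstoD(2)[of _ 0]) (auto simp: qnil_def)
  with eventually_gt_at_top[of 0]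
  show "\<forall>\<^sub>F n in sequentially. norm (norm (c n *\<^sub>R w ^ n)) \<le> (1/2) ^ n"
  proof eventually_elim
    case (elim n)
    have "norm (w ^ n) = root n (norm (w ^ n)) ^ n"
      using elim by (simp add: real_root_pow_pos2)
    also have "\<dots> \<le> (1/2) ^ n"
      using elim by (intro power_mono) (auto simp: real_root_ge_zero)
    finally have "\<bar>c n\<bar> * norm (w ^ n) \<le> 1 * (1/2) ^ n"
      by (intro mult_mono c) auto
    then show ?case by simp
  qed
qed simp

lemmas summable_qnil_powser = summable_norm_cancel[OF summable_norm_qnil_powser]

lemma suminf_commute:
  fixes f :: "nat \<Rightarrow> 'a::real_normed_algebra"
  assumes "summable f" "\<And>n. g * f n = f n * g"
  shows "g * suminf f = suminf f * g"
  using suminf_mult[OF assms(1), of g] suminf_mult2[OF assms(1), of g] assms(2) by simp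

lemma powser_commute:
  fixes w :: "'a::{real_normed_algebra,monoid_mult}"
  assumes "summable (\<lambda>n. c n *\<^sub>R w ^ n)" "g * w = w * g"
  shows "g * (\<Sum>n. c n *\<^sub>R w ^ n) = (\<Sum>n. c n *\<^sub>R w ^ n) * g"
proof (rule suminf_commute[OF assms(1)])
  fix n show "g * c n *\<^sub>R w ^ n = c n *\<^sub>R w ^ n * g"
    using power_commuting_commutes[of w g n] assms(2) by simp
qed

lemma neumann_qnil:
  assumes "w \<in> qnil"
  shows "(1 - w) * (\<Sum>n. w ^ n) = 1"
proof -
  have sm: "summable (\<lambda>n. w ^ n)"
    using summable_qnil_powser[OF assms, of "\<lambda>_. 1"] by simp
  show ?thesis
    using suminf_split_head[OF sm] suminf_mult[OF sm, of w] by (simp add: left_diff_distrib)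
qed

text \<open>The Taylor coefficients of \<open>(1 - X)\<^bsup>-1/2\<^esup>\<close>.\<close>

definition inv_sqrt_coeff :: "nat \<Rightarrow> real" where
  "inv_sqrt_coeff n = pochhammer (1/2) n / fact n"

lemma inv_sqrt_coeff_0 [simp]: "inv_sqrt_coeff 0 = 1"
  by (simp add: inv_sqrt_coeff_def)

text \<open>Consecutive coefficients have ratio (n + 1/2) / (n + 1), which is below 1.\<close>

lemma abs_inv_sqrt_coeff_le: "\<bar>inv_sqrt_coeff n\<bar> \<le> 1"
proof (induction n)
  case (Suc n)
  have "inv_sqrt_coeff (Suc n) = inv_sqrt_coeff n * ((1/2 + real n) / (1 + real n))"
    by (simp add: inv_sqrt_coeff_def pochhammer_Suc)
  moreover have "\<bar>(1/2 + real n) / (1 + real n)\<bar> \<le> 1"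
    by simp
  ultimately show ?case
    by (simp only: abs_mult mult_le_one[OF Suc abs_ge_zero])
qed simp

text \<open>Vandermonde's identity for rising factorials at 1/2 + 1/2 = 1. As power series, it says
  that the square of the inverse square root of 1 - X is the geometric series.\<close>

lemma inv_sqrt_coeff_convolution: "(\<Sum>k\<le>n. inv_sqrt_coeff k * inv_sqrt_coeff (n - k)) = 1"
proof -
  have "fact n = pochhammer (1/2 + 1/2 :: real) n"
    by (simp add: pochhammer_fact)
  also have "\<dots> = (\<Sum>k\<le>n. (n choose k) * pochhammer (1/2) k * pochhammer (1/2) (n - k))"
    by (rule pochhammer_binomial_sum)
  also have "\<dots> = (\<Sum>k\<le>n. fact n * (inv_sqrt_coeff k * inv_sqrt_coeff (n - k)))"
    by (intro sum.cong) (auto simp: inv_sqrt_coeff_def binomial_fact)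
  finally show ?thesis
    by (simp flip: sum_distrib_left)
qed

text \<open>The Cauchy square of the series is the Neumann series of \<open>w\<close>. Splitting off
  the constant term as \<open>1 + w * t\<close> keeps the factor \<open>w\<close> visible, which
  later makes \<open>p - e\<close> a multiple of \<open>y\<close>.\<close>

lemma inv_sqrt_qnil:
  fixes w :: "'a::complex_banach_algebra_1"
  assumes w: "w \<in> qnil"
  defines "t \<equiv> \<Sum>n. inv_sqrt_coeff (Suc n) *\<^sub>R w ^ n"
  shows "(1 - w) * ((1 + w * t) * (1 + w * t)) = 1"
proof -
  let ?f = "\<lambda>n. inv_sqrt_coeff n *\<^sub>R w ^ n"
  have nm: "summable (\<lambda>n. norm (?f n))"
    by (rule summable_norm_qnil_powser[OF w abs_inv_sqrt_coeff_le])
  have st: "summable (\<lambda>n. inv_sqrt_coeff (Suc n) *\<^sub>R w ^ n)"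
    by (rule summable_qnil_powser[OF w abs_inv_sqrt_coeff_le])
  have "suminf ?f - 1 = w * t"
    using suminf_split_head[OF summable_norm_cancel[OF nm]] suminf_mult[OF st, of w]
    by (simp add: t_def)
  then have "suminf ?f = 1 + w * t"
    by (metis add.commute diff_add_cancel)
  moreover have "suminf ?f * suminf ?f = (\<Sum>n. \<Sum>k\<le>n. ?f k * ?f (n - k))"
    by (rule Cauchy_product[OF nm nm])
  moreover have "(\<Sum>k\<le>n. ?f k * ?f (n - k)) = w ^ n" for n
  proof -
    have "(\<Sum>k\<le>n. ?f k * ?f (n - k))
        = (\<Sum>k\<le>n. (inv_sqrt_coeff k * inv_sqrt_coeff (n - k)) *\<^sub>R w ^ n)"
      by (intro sum.cong) (auto simp flip: power_add)
    also have "\<dots> = w ^ n"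
      by (simp add: inv_sqrt_coeff_convolution flip: scaleR_left.sum)
    finally show ?thesis .
  qed
  ultimately show ?thesis
    using neumann_qnil[OF w] by simp
qed

lemma comm_imp_gDrazin_inverse:
  fixes a x :: "'a::complex_banach_algebra_1"
  assumes xa: "x * a = a * x" and y: "a - a\<^sup>2 * x \<in> qnil"
  shows "\<exists>b. is_gDrazin_inverse a b"
proof -
  define y where "y = a - a\<^sup>2 * x"
  define e where "e = a * x"
  define w where "w = 4 *\<^sub>R (e - e * e)"
  define h where "h = 2 *\<^sub>R e - 1"
  define t where "t = (\<Sum>n. inv_sqrt_coeff (Suc n) *\<^sub>R w ^ n)"
  define s where "s = 1 + w * t"
  define p where "p = (1/2) *\<^sub>R (1 + h * s)"
  \<comment> \<open>Chosen so that \<open>p - e = y * z\<close>: the error is half of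
    \<open>h * (w * t)\<close>, and \<open>w\<close> is \<open>y\<close> times
    \<open>4 *\<^sub>R x\<close>.\<close>
  define z where "z = 2 *\<^sub>R (x * (h * t))"
  define r where "r = y * z"
  define v where "v = (\<Sum>n. r ^ n)"
  define b where "b = x * p * v"
  have ye: "y = a - a * e" by (simp add: y_def e_def power2_eq_square mult.assoc)
  have ae: "a * e = e * a" and xe: "x * e = e * x"
    unfolding e_def using xa by (metis mult.assoc)+
  have ay: "a * y = y * a" and xy: "x * y = y * x"
    unfolding ye right_diff_distrib left_diff_distrib using xa ae xe by (metis mult.assoc)+
  have wy: "w = y * (4 *\<^sub>R x)"
    unfolding w_def ye using xe
    by (simp add: left_diff_distrib mult.assoc) (simp add: e_def mult.assoc)
  have y: "y \<in> qnil" using y by (simp add: y_def)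
  have wq: "w \<in> qnil"
    unfolding wy by (rule qnil_mult_commuting[OF y]) (simp add: xy)
  have t_commute: "g * t = t * g" if "g * w = w * g" for g
    unfolding t_def
    by (rule powser_commute[OF summable_qnil_powser[OF wq abs_inv_sqrt_coeff_le] that])
  \<comment> \<open>Everything is built from \<open>a\<close> and \<open>x\<close>, so whatever
    commutes with these two commutes with the rest. Taking \<open>g\<close> to be \<open>a\<close>
    and \<open>x\<close> first, then \<open>h\<close>, \<open>p\<close> and \<open>y\<close>, yields
    the commutation facts used below.\<close>
  have commutes: "g * y = y * g" "g * e = e * g" "g * h = h * g" "g * w = w * g" "g * t = t * g"
      "g * s = s * g" "g * p = p * g" "g * z = z * g" "g * r = r * g"
    if g: "g * a = a * g" "g * x = x * g" for g
  proof -
    show e: "g * e = e * g" unfolding e_def using g by (metis mult.assoc)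
    show y: "g * y = y * g"
      unfolding ye right_diff_distrib left_diff_distrib using g e by (metis mult.assoc)
    show h: "g * h = h * g" unfolding h_def by (simp add: right_diff_distrib left_diff_distrib e)
    show w: "g * w = w * g" unfolding wy using g(2) y
      by simp (metis mult.assoc)
    show t: "g * t = t * g" by (rule t_commute[OF w])
    show s: "g * s = s * g"
      unfolding s_def distrib_left distrib_right using w t by (simp, metis mult.assoc)
    show p: "g * p = p * g"
      unfolding p_def using h s by (simp add: distrib_left distrib_right) (metis mult.assoc)
    show z: "g * z = z * g"
      unfolding z_def using g h t by simp (metis mult.assoc)
    show "g * r = r * g"
      unfolding r_def using y z by (metis mult.assoc)
  qed
  note ca = commutes[OF refl xa[symmetric]]
  note cx = commutes[OF xa refl]
  note ch = commutes[OF ca(3)[symmetric] cx(3)[symmetric]]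
  note cp = commutes[OF ca(7)[symmetric] cx(7)[symmetric]]
  note cy = commutes[OF ca(1)[symmetric] cx(1)[symmetric]]
  have rq: "r \<in> qnil"
    unfolding r_def by (rule qnil_mult_commuting[OF y cy(8)])
  have v_commute: "g * v = v * g" if "g * r = r * g" for g
    using powser_commute[of "\<lambda>_. 1" r g] summable_qnil_powser[OF rq, of "\<lambda>_. 1"] that
    by (simp add: v_def)
  have hh: "h * h = 1 - w"
    by (simp add: h_def w_def algebra_simps flip: scaleR_add_left)
  \<comment> \<open>\<open>h * s\<close> squares to 1, and half of 1 plus an involution is
    idempotent.\<close>
  have "(h * s) * (h * s) = (h * h) * (s * s)"
    using ch(6) by (metis mult.assoc)
  also have "\<dots> = 1"
    unfolding hh s_def t_def by (rule inv_sqrt_qnil[OF wq])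
  finally have "(1 + h * s) * (1 + h * s) = 2 *\<^sub>R (1 + h * s)"
    by (simp add: distrib_left distrib_right scaleR_2)
  then have pp: "p * p = p" by (simp add: p_def)
  \<comment> \<open>Here \<open>(1 + h) / 2\<close> is \<open>e\<close>, so only the
    \<open>w * t\<close> part of \<open>s\<close> survives.\<close>
  have "p - e = (1/2) *\<^sub>R (h * (w * t))"
    by (simp add: p_def s_def h_def distrib_left scaleR_add_right scaleR_diff_right)
  also have "h * (w * t) = y * (4 *\<^sub>R (x * (h * t)))"
    unfolding wy using ch(1) cx(3) by simp (metis mult.assoc)
  finally have pe: "p = e + r"
    by (simp add: r_def z_def algebra_simps)
  have v: "(1 - r) * v = 1" unfolding v_def by (rule neumann_qnil[OF rq])
  have av: "a * v = v * a" by (rule v_commute[OF ca(9)])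
  have xv: "x * v = v * x" by (rule v_commute[OF cx(9)])
  have pv: "p * v = v * p" by (rule v_commute[OF cp(9)])
  have "e * p = p - r * p" using pp pe by (metis add_diff_cancel_right' left_diff_distrib)
  then have ep: "e * p = p * (1 - r)" by (simp add: right_diff_distrib cp(9))
  have "a * b = e * p * v" by (simp add: b_def e_def mult.assoc)
  also have "\<dots> = p" unfolding ep mult.assoc v by simp
  finally have ab: "a * b = p" .
  have ba: "b * a = a * b"
    unfolding b_def using ca(7) av xa by (metis mult.assoc)
  have "p * b = b"
    unfolding b_def using cx(7) pp by (metis mult.assoc)
  then have bab: "b = b * a * b" by (simp add: ba ab)
  have "a - a\<^sup>2 * b = a - a * p" by (simp add: power2_eq_square mult.assoc ab)
  \<comment> \<open>Substituting \<open>p = e + r\<close> turns \<open>a - a * e\<close> into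
    \<open>y\<close> and leaves \<open>a * r\<close>, which also contains the factor
    \<open>y\<close>.\<close>
  also have "\<dots> = y - a * (y * z)" by (simp add: pe ye r_def distrib_left)
  also have "\<dots> = y * (1 - a * z)"
    using ay by (simp add: right_diff_distrib) (metis mult.assoc)
  also have "\<dots> \<in> qnil"
  proof (rule qnil_mult_commuting[OF y])
    have "y * (a * z) = a * z * y" using ay cy(8) by (metis mult.assoc)
    then show "y * (1 - a * z) = (1 - a * z) * y"
      by (simp add: right_diff_distrib left_diff_distrib)
  qed
  finally show ?thesis
    using ba bab unfolding is_gDrazin_inverse_def by metis
qed

theorem theorem2p2:
  fixes a :: "'a::complex_banach_algebra_1"
  shows "a \<in> gDrazin_invertible \<longleftrightarrow> (\<exists>x\<in>comm a. a - a\<^sup>2 * x \<in> qnil)"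
proof
  assume "a \<in> gDrazin_invertible"
  \<comment> \<open>A g-Drazin inverse of \<open>a\<close> itself serves as
    \<open>x\<close>.\<close>
  then obtain b where "a * b = b * a" "a - a\<^sup>2 * b \<in> qnil"
    by (auto simp: gDrazin_invertible_def is_gDrazin_inverse_def)
  then show "\<exists>x\<in>comm a. a - a\<^sup>2 * x \<in> qnil"
    by (intro bexI[of _ b]) (simp_all add: comm_def)
next
  assume "\<exists>x\<in>comm a. a - a\<^sup>2 * x \<in> qnil"
  then show "a \<in> gDrazin_invertible"
    using comm_imp_gDrazin_inverse by (auto simp: gDrazin_invertible_def comm_def)
qed

end
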